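(* Let $E,F$ be complex Banach spaces, $U$ an open subset of $E$, $1<p\leq\infty$ and $f\in\mathcal{H}^\infty(U,F)$. Then $f\in\mathcal{D}_p^{\mathcal{H}^\infty}(U,F)$ if and only if $f^t\in\Pi_{p^*}(F^*,\mathcal{H}^\infty(U))$. In this case, $d_p^{\mathcal{H}^\infty}(f)=\pi_{p^*}(f^t)$.
   Context: $\mathcal{H}^\infty(U,F)$ is the Banach space of bounded holomorphic mappings $U\to F$ with the supremum norm, $\mathcal{H}^\infty(U)=\mathcal{H}^\infty(U,\mathbb{C})$. The transpose of $f\in\mathcal{H}^\infty(U,F)$ is the bounded linear operator $f^t\colon F^*\to\mathcal{H}^\infty(U)$, $f^t(y^* )=y^*\circ f$. $B_X$ is the closed unit ball of $X$; $p^*$ is the conjugate index of $p$ ($\infty^*=1$). A holomorphic $f\colon U\to F$ is Cohen strongly $p$-summing if there is $C\geq0$ such that for all $n\in\mathbb{N}$, $\lambda_i\in\mathbb{C}$, $x_i\in U$, $y_i^*\in F^*$ ($1\le i\le n$), $\sum_{i=1}^n|\lambda_i||\langle y_i^*,f(x_i)\rangle|\leq C\|(\lambda_i)\|_{\ell_p^n}\sup_{y^{**}\in B_{F^{**}}}(\sum_i|y^{**}(y_i^* )|^{p^*})^{1/p^*}$, where $\|(\lambda_i)\|_{\ell_p^n}=(\sum_i|\lambda_i|^p)^{1/p}$ ($\max_i|\lambda_i|$ if $p=\infty$); $d_p^{\mathcal{H}^\infty}(f)$ is the infimum of such $C$ and $\mathcal{D}_p^{\mathcal{H}^\infty}(U,F)$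 the set of such mappings. For $1\leq q<\infty$, a bounded linear operator $T\colon X\to Y$ between Banach spaces is $q$-summing, $T\in\Pi_q(X,Y)$, if there is $C\geq0$ with $(\sum_{i=1}^n\|T(x_i)\|^q)^{1/q}\leq C\sup_{x^*\in B_{X^*}}(\sum_{i=1}^n|x^*(x_i)|^q)^{1/q}$ for all $n\in\mathbb{N}$, $x_1,\dots,x_n\in X$; $\pi_q(T)$ is the infimum of such $C$. *)

theory Defs
  imports "HOL-Analysis.Analysis"
begin

section \<open>Complex normed spaces\<close>

class scaleC =
  fixes scaleC :: "complex \<Rightarrow> 'a \<Rightarrow> 'a"  (infixr "*\<^sub>C" 75)

class complex_normed_vector = real_normed_vector + scaleC +
  assumes scaleC_add_right: "a *\<^sub>C (x + y) = a *\<^sub>C x + a *\<^sub>C y"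
    and scaleC_add_left: "(a + b) *\<^sub>C x = a *\<^sub>C x + b *\<^sub>C x"
    and scaleC_scaleC: "a *\<^sub>C (b *\<^sub>C x) = (a * b) *\<^sub>C x"
    and scaleC_of_real: "complex_of_real r *\<^sub>C x = r *\<^sub>R x"
    and norm_scaleC: "norm (a *\<^sub>C x) = cmod a * norm x"

class cbanach = complex_normed_vector + complete_space

instantiation complex :: cbanach
begin

definition scaleC_complex :: "complex \<Rightarrow> complex \<Rightarrow> complex"
  where scaleC_complex_def [simp]: "scaleC_complex a x = a * x"

instance
  by standard (simp_all add: algebra_simps norm_mult scaleR_conv_of_real)

end

definition bounded_clinear ::
    "('a::complex_normed_vector \<Rightarrow> 'b::complex_normed_vector) \<Rightarrow> bool"
  where "bounded_clinear f \<longleftrightarrow> bounded_linear f \<and> (\<forall>c x. f (c *\<^sub>C x) = c *\<^sub>C f x)"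

lemma bounded_clinearD: "bounded_clinear f \<Longrightarrow> bounded_linear f"
  by (simp add: bounded_clinear_def)


section \<open>The dual of a complex normed space\<close>

typedef (overloaded) 'a cdual = "{f :: 'a::complex_normed_vector \<Rightarrow> complex. bounded_clinear f}"
  morphisms cdual_apply Cdual
  by (rule exI[of _ "\<lambda>_. 0"]) (simp add: bounded_clinear_def)

setup_lifting type_definition_cdual

lemma onorm_mult_complex:
  fixes f :: "'a::real_normed_vector \<Rightarrow> complex"
  assumes f: "bounded_linear f"
  shows "onorm (\<lambda>x. c * f x) = cmod c * onorm f"
proof (cases "c = 0")
  case True
  then show ?thesis by (simp add: onorm_zero)
next
  case False
  have le: "onorm (\<lambda>x. a * g x) \<le> cmod a * onorm g" if "bounded_linear g"
    for a and g :: "'a \<Rightarrow> complex"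
    using onorm[OF that] onorm_pos_le[OF that]
    by (intro onorm_bound) (auto simp: norm_mult mult.assoc intro!: mult_left_mono)
  have "onorm f = onorm (\<lambda>x. inverse c * (c * f x))"
    using False by (simp add: mult.assoc[symmetric])
  also have "\<dots> \<le> cmod (inverse c) * onorm (\<lambda>x. c * f x)"
    by (rule le) (rule bounded_linear_const_mult[OF f])
  finally have "cmod c * onorm f \<le> onorm (\<lambda>x. c * f x)"
    using False by (simp add: norm_divide field_simps)
  with le[OF f, of c] show ?thesis by simp
qed

instantiation cdual :: (complex_normed_vector) complex_normed_vector
begin

lift_definition norm_cdual :: "'a cdual \<Rightarrow> real" is onorm .

lift_definition zero_cdual :: "'a cdual" is "\<lambda>x. 0"
  by (simp add: bounded_clinear_def)

lift_definition plus_cdual :: "'a cdual \<Rightarrow> 'a cdual \<Rightarrow> 'a cdual" is "\<lambda>f g x. f x + g x"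
  by (simp add: bounded_clinear_def bounded_linear_add distrib_left)

lift_definition minus_cdual :: "'a cdual \<Rightarrow> 'a cdual \<Rightarrow> 'a cdual" is "\<lambda>f g x. f x - g x"
  by (simp add: bounded_clinear_def bounded_linear_sub right_diff_distrib)

lift_definition uminus_cdual :: "'a cdual \<Rightarrow> 'a cdual" is "\<lambda>f x. - f x"
  by (simp add: bounded_clinear_def bounded_linear_minus)

lift_definition scaleC_cdual :: "complex \<Rightarrow> 'a cdual \<Rightarrow> 'a cdual" is "\<lambda>c f x. c * f x"
  by (simp add: bounded_clinear_def bounded_linear_const_mult)

lift_definition scaleR_cdual :: "real \<Rightarrow> 'a cdual \<Rightarrow> 'a cdual" is "\<lambda>r f x. r *\<^sub>R f x"
  by (simp add: bounded_clinear_def bounded_linear_scaleR_const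
      bounded_linear_compose[OF bounded_linear_scaleR_right])

definition dist_cdual :: "'a cdual \<Rightarrow> 'a cdual \<Rightarrow> real"
  where "dist_cdual f g = norm (f - g)"

definition sgn_cdual :: "'a cdual \<Rightarrow> 'a cdual"
  where "sgn_cdual f = inverse (norm f) *\<^sub>R f"

definition uniformity_cdual :: "('a cdual \<times> 'a cdual) filter"
  where "uniformity_cdual = (INF e\<in>{0 <..}. principal {(f, g). dist f g < e})"

definition open_cdual :: "'a cdual set \<Rightarrow> bool"
  where "open_cdual S = (\<forall>f\<in>S. \<forall>\<^sub>F (f', g) in uniformity. f' = f \<longrightarrow> g \<in> S)"

instance
proof
  fix f g h :: "'a cdual" and a b :: complex and r s :: real
  show "f + g + h = f + (g + h)" by transfer (simp add: add.assoc)
  show "f + g = g + f" by transfer (simp add: add.commute)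
  show "0 + f = f" by transfer simp
  show "- f + f = 0" by transfer simp
  show "f - g = f + - g" by transfer simp
  show "r *\<^sub>R (f + g) = r *\<^sub>R f + r *\<^sub>R g" by transfer (simp add: scaleR_add_right)
  show "(r + s) *\<^sub>R f = r *\<^sub>R f + s *\<^sub>R f" by transfer (simp add: scaleR_add_left)
  show "r *\<^sub>R s *\<^sub>R f = (r * s) *\<^sub>R f" by transfer simp
  show "1 *\<^sub>R f = f" by transfer simp
  show "sgn f = inverse (norm f) *\<^sub>R f" by (rule sgn_cdual_def)
  show "dist f g = norm (f - g)" by (rule dist_cdual_def)
  show "(uniformity :: ('a cdual \<times> 'a cdual) filter)
      = (INF e\<in>{0 <..}. principal {(f, g). dist f g < e})"
    by (rule uniformity_cdual_def)
  show "open S = (\<forall>f\<in>S. \<forall>\<^sub>F (f', g) in uniformity. f' = f \<longrightarrow> g \<in> S)" for S :: "'a cdual set"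
    by (rule open_cdual_def)
  show "(norm f = 0) = (f = 0)"
    by transfer (auto simp: onorm_eq_0 fun_eq_iff dest: bounded_clinearD)
  show "norm (f + g) \<le> norm f + norm g"
    by transfer (simp add: onorm_triangle bounded_clinearD)
  show "norm (r *\<^sub>R f) = \<bar>r\<bar> * norm f"
    by transfer (simp add: onorm_scaleR bounded_clinearD del: scaleR_conv_of_real)
  show "a *\<^sub>C (f + g) = a *\<^sub>C f + a *\<^sub>C g" by transfer (simp add: distrib_left)
  show "(a + b) *\<^sub>C f = a *\<^sub>C f + b *\<^sub>C f" by transfer (simp add: distrib_right)
  show "a *\<^sub>C b *\<^sub>C f = (a * b) *\<^sub>C f" by transfer (simp add: mult.assoc)
  show "complex_of_real r *\<^sub>C f = r *\<^sub>R f" by transfer (simp add: scaleR_conv_of_real)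
  show "norm (a *\<^sub>C f) = cmod a * norm f"
    by transfer (simp add: onorm_mult_complex bounded_clinearD)
qed

end


section \<open>Bounded functions with the supremum norm\<close>

typedef (overloaded) ('a, 'b) bfun =
    "{f :: 'a \<Rightarrow> 'b::complex_normed_vector. bounded (range f)}"
  morphisms bfun_apply Bfun
  by (rule exI[of _ "\<lambda>_. 0"]) auto

setup_lifting type_definition_bfun

lemma bounded_range_iff: "bounded (range f) \<longleftrightarrow> (\<exists>B. \<forall>x. norm (f x) \<le> B)"
  by (auto simp: bounded_iff)

lemma norm_le_SUP_norm:
  fixes f :: "'a \<Rightarrow> 'b::real_normed_vector"
  assumes "bounded (range f)"
  shows "norm (f x) \<le> (SUP x. norm (f x))"
  using assms by (intro cSUP_upper) (auto simp: bounded_range_iff bdd_above_def)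

lemma bounded_range_scaleC:
  fixes f :: "'a \<Rightarrow> 'b::complex_normed_vector"
  assumes "bounded (range f)"
  shows "bounded (range (\<lambda>x. c *\<^sub>C f x))"
proof -
  from assms obtain B where "\<And>x. norm (f x) \<le> B" by (auto simp: bounded_range_iff)
  then have "norm (c *\<^sub>C f x) \<le> cmod c * B" for x
    by (simp add: norm_scaleC mult_left_mono)
  then show ?thesis by (auto simp: bounded_range_iff)
qed

lemma SUP_norm_scaleC:
  fixes f :: "'a \<Rightarrow> 'b::complex_normed_vector"
  assumes f: "bounded (range f)"
  shows "(SUP x. norm (c *\<^sub>C f x)) = cmod c * (SUP x. norm (f x))"
proof (cases "c = 0")
  case True
  then show ?thesis by (simp add: norm_scaleC)
next
  case False
  show ?thesis
  proof (rule antisym)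
    show "(SUP x. norm (c *\<^sub>C f x)) \<le> cmod c * (SUP x. norm (f x))"
      using norm_le_SUP_norm[OF f] by (intro cSUP_least) (auto simp: norm_scaleC mult_left_mono)
    have "norm (f x) \<le> (SUP x. norm (c *\<^sub>C f x)) / cmod c" for x
      using norm_le_SUP_norm[OF bounded_range_scaleC[OF f], of c x] False
      by (simp add: norm_scaleC field_simps)
    then have "(SUP x. norm (f x)) \<le> (SUP x. norm (c *\<^sub>C f x)) / cmod c"
      by (intro cSUP_least) auto
    then show "cmod c * (SUP x. norm (f x)) \<le> (SUP x. norm (c *\<^sub>C f x))"
      using False by (simp add: field_simps)
  qed
qed

instantiation bfun :: (type, complex_normed_vector) complex_normed_vector
begin

lift_definition norm_bfun :: "('a, 'b) bfun \<Rightarrow> real" is "\<lambda>f. SUP x. norm (f x)" .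

lift_definition zero_bfun :: "('a, 'b) bfun" is "\<lambda>x. 0"
  by auto

lift_definition plus_bfun :: "('a, 'b) bfun \<Rightarrow> ('a, 'b) bfun \<Rightarrow> ('a, 'b) bfun"
  is "\<lambda>f g x. f x + g x"
  by (rule bounded_plus_comp)

lift_definition minus_bfun :: "('a, 'b) bfun \<Rightarrow> ('a, 'b) bfun \<Rightarrow> ('a, 'b) bfun"
  is "\<lambda>f g x. f x - g x"
  by (rule bounded_minus_comp)

lift_definition uminus_bfun :: "('a, 'b) bfun \<Rightarrow> ('a, 'b) bfun" is "\<lambda>f x. - f x"
  by (simp add: bounded_range_iff)

lift_definition scaleC_bfun :: "complex \<Rightarrow> ('a, 'b) bfun \<Rightarrow> ('a, 'b) bfun" is "\<lambda>c f x. c *\<^sub>C f x"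
  by (rule bounded_range_scaleC)

lift_definition scaleR_bfun :: "real \<Rightarrow> ('a, 'b) bfun \<Rightarrow> ('a, 'b) bfun" is "\<lambda>r f x. r *\<^sub>R f x"
  by (rule bounded_scaleR_comp)

definition dist_bfun :: "('a, 'b) bfun \<Rightarrow> ('a, 'b) bfun \<Rightarrow> real"
  where "dist_bfun f g = norm (f - g)"

definition sgn_bfun :: "('a, 'b) bfun \<Rightarrow> ('a, 'b) bfun"
  where "sgn_bfun f = inverse (norm f) *\<^sub>R f"

definition uniformity_bfun :: "(('a, 'b) bfun \<times> ('a, 'b) bfun) filter"
  where "uniformity_bfun = (INF e\<in>{0 <..}. principal {(f, g). dist f g < e})"

definition open_bfun :: "('a, 'b) bfun set \<Rightarrow> bool"
  where "open_bfun S = (\<forall>f\<in>S. \<forall>\<^sub>F (f', g) in uniformity. f' = f \<longrightarrow> g \<in> S)"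

instance
proof
  fix f g h :: "('a, 'b) bfun" and a b :: complex and r s :: real
  show "f + g + h = f + (g + h)" by transfer (simp add: add.assoc)
  show "f + g = g + f" by transfer (simp add: add.commute)
  show "0 + f = f" by transfer simp
  show "- f + f = 0" by transfer simp
  show "f - g = f + - g" by transfer simp
  show "r *\<^sub>R (f + g) = r *\<^sub>R f + r *\<^sub>R g" by transfer (simp add: scaleR_add_right)
  show "(r + s) *\<^sub>R f = r *\<^sub>R f + s *\<^sub>R f" by transfer (simp add: scaleR_add_left)
  show "r *\<^sub>R s *\<^sub>R f = (r * s) *\<^sub>R f" by transfer simp
  show "1 *\<^sub>R f = f" by transfer simp
  show "sgn f = inverse (norm f) *\<^sub>R f" by (rule sgn_bfun_def)
  show "dist f g = norm (f - g)" by (rule dist_bfun_def)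
  show "(uniformity :: (('a, 'b) bfun \<times> ('a, 'b) bfun) filter)
      = (INF e\<in>{0 <..}. principal {(f, g). dist f g < e})"
    by (rule uniformity_bfun_def)
  show "open S = (\<forall>f\<in>S. \<forall>\<^sub>F (f', g) in uniformity. f' = f \<longrightarrow> g \<in> S)" for S :: "('a, 'b) bfun set"
    by (rule open_bfun_def)
  show "(norm f = 0) = (f = 0)"
  proof
    assume "norm f = 0"
    then show "f = 0"
    proof transfer
      fix f :: "'a \<Rightarrow> 'b"
      assume "bounded (range f)" "(SUP x. norm (f x)) = 0"
      with norm_le_SUP_norm[of f] show "f = (\<lambda>x. 0)" by auto
    qed
  next
    assume "f = 0"
    then show "norm f = 0" by transfer simp
  qed
  show "norm (f + g) \<le> norm f + norm g"
  proof transfer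
    fix f g :: "'a \<Rightarrow> 'b"
    assume "bounded (range f)" "bounded (range g)"
    then show "(SUP x. norm (f x + g x)) \<le> (SUP x. norm (f x)) + (SUP x. norm (g x))"
      by (intro cSUP_least) (auto intro!: order_trans[OF norm_triangle_ineq] add_mono norm_le_SUP_norm)
  qed
  show "a *\<^sub>C (f + g) = a *\<^sub>C f + a *\<^sub>C g" by transfer (simp add: scaleC_add_right)
  show "(a + b) *\<^sub>C f = a *\<^sub>C f + b *\<^sub>C f" by transfer (simp add: scaleC_add_left)
  show "a *\<^sub>C b *\<^sub>C f = (a * b) *\<^sub>C f" by transfer (simp add: scaleC_scaleC)
  have eq: "complex_of_real r *\<^sub>C f = r *\<^sub>R f" by transfer (simp add: scaleC_of_real)
  then show "complex_of_real r *\<^sub>C f = r *\<^sub>R f" .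
  have norm_eq: "norm (a *\<^sub>C f) = cmod a * norm f" for a
    by transfer (rule SUP_norm_scaleC)
  then show "norm (a *\<^sub>C f) = cmod a * norm f" .
  show "norm (r *\<^sub>R f) = \<bar>r\<bar> * norm f"
    using norm_eq[of "complex_of_real r"] by (simp add: eq)
qed

end


section \<open>Bounded holomorphic mappings\<close>

text \<open>
  Complex Frechet differentiability: the real Frechet derivative exists and is complex linear.
  Only used for open \<open>U\<close>.
\<close>

definition holomorphic_map_on ::
    "('e::complex_normed_vector \<Rightarrow> 'f::complex_normed_vector) \<Rightarrow> 'e set \<Rightarrow> bool"
  where "holomorphic_map_on f U \<longleftrightarrow>
    (\<forall>x\<in>U. \<exists>D. bounded_clinear D \<and> (f has_derivative D) (at x))"

text \<open>
  A mapping on \<open>U\<close> is represented by its extension by \<open>0\<close> to the whole type. For \<open>g \<in> Hinf U\<close> the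
  supremum over the type that defines \<open>norm g\<close> is therefore the supremum over \<open>U\<close>
  (and \<open>0\<close> if \<open>U\<close> is empty).
\<close>

definition Hinf :: "'e::complex_normed_vector set \<Rightarrow> ('e, 'f::complex_normed_vector) bfun set"
  where "Hinf U = {g. holomorphic_map_on (bfun_apply g) U \<and> (\<forall>x. x \<notin> U \<longrightarrow> bfun_apply g x = 0)}"

lemma bounded_linear_scaleC: "bounded_linear (\<lambda>x::'a::complex_normed_vector. c *\<^sub>C x)"
proof (rule bounded_linear_intro[where K = "cmod c"])
  fix x y :: 'a and r :: real
  show "c *\<^sub>C (x + y) = c *\<^sub>C x + c *\<^sub>C y" by (rule scaleC_add_right)
  show "c *\<^sub>C r *\<^sub>R x = r *\<^sub>R c *\<^sub>C x"
    by (simp add: scaleC_of_real[symmetric] scaleC_scaleC mult.commute)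
  show "norm (c *\<^sub>C x) \<le> norm x * cmod c" by (simp add: norm_scaleC mult.commute)
qed

lemma scaleC_zero_right: "c *\<^sub>C (0::'a::complex_normed_vector) = 0"
  using norm_scaleC[of c "0::'a"] by simp

lemma Hinf_zero: "0 \<in> Hinf U"
  by (auto simp: Hinf_def holomorphic_map_on_def zero_bfun.rep_eq bounded_clinear_def
      scaleC_zero_right intro!: exI[of _ "\<lambda>_. 0"])

lemma Hinf_add: "g + h \<in> Hinf U" if "g \<in> Hinf U" "h \<in> Hinf U"
proof -
  have "\<exists>D. bounded_clinear D \<and> ((\<lambda>x. bfun_apply g x + bfun_apply h x) has_derivative D) (at x)"
    if "x \<in> U" for x
  proof -
    from \<open>g \<in> Hinf U\<close> \<open>h \<in> Hinf U\<close> \<open>x \<in> U\<close> obtain D D' where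
      "bounded_clinear D" "(bfun_apply g has_derivative D) (at x)"
      "bounded_clinear D'" "(bfun_apply h has_derivative D') (at x)"
      unfolding Hinf_def holomorphic_map_on_def by blast
    then show ?thesis
      by (intro exI[of _ "\<lambda>v. D v + D' v"])
        (auto simp: bounded_clinear_def bounded_linear_add scaleC_add_right intro: has_derivative_add)
  qed
  with that show ?thesis
    by (simp add: Hinf_def holomorphic_map_on_def plus_bfun.rep_eq)
qed

lemma Hinf_scaleC: "c *\<^sub>C g \<in> Hinf U" if "g \<in> Hinf U"
proof -
  have "\<exists>D. bounded_clinear D \<and> ((\<lambda>x. c *\<^sub>C bfun_apply g x) has_derivative D) (at x)"
    if "x \<in> U" for x
  proof -
    from \<open>g \<in> Hinf U\<close> \<open>x \<in> U\<close> obtain D where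
      "bounded_clinear D" "(bfun_apply g has_derivative D) (at x)"
      unfolding Hinf_def holomorphic_map_on_def by blast
    then show ?thesis
      by (intro exI[of _ "\<lambda>v. c *\<^sub>C D v"])
        (auto simp: bounded_clinear_def scaleC_scaleC mult.commute
          intro: bounded_linear_compose[OF bounded_linear_scaleC]
            bounded_linear.has_derivative[OF bounded_linear_scaleC])
  qed
  with that show ?thesis
    by (simp add: Hinf_def holomorphic_map_on_def scaleC_bfun.rep_eq scaleC_zero_right)
qed

text \<open>
  The transpose \<open>y \<mapsto> y \<circ> f\<close>; if \<open>f\<close> vanishes outside \<open>U\<close>, so does \<open>y \<circ> f\<close>.
\<close>

lift_definition transpose_map ::
    "('e, 'f::complex_normed_vector) bfun \<Rightarrow> 'f cdual \<Rightarrow> ('e, complex) bfun"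
  is "\<lambda>f y x. y (f x)"
  by (metis bounded_clinearD bounded_linear_image image_image)


section \<open>Summing mappings\<close>

definition conjugate_index :: "ereal \<Rightarrow> ereal"
  where "conjugate_index p =
    (if p = \<infinity> then 1 else if p = 1 then \<infinity>
     else ereal (real_of_ereal p / (real_of_ereal p - 1)))"

text \<open>The \<open>\<ell>\<^sub>p\<^sup>n\<close> norm of \<open>(\<parallel>x 0\<parallel>, \<dots>, \<parallel>x (n - 1)\<parallel>)\<close>.\<close>

definition lp_norm :: "ereal \<Rightarrow> nat \<Rightarrow> (nat \<Rightarrow> 'a::real_normed_vector) \<Rightarrow> real"
  where "lp_norm p n x =
    (if p = \<infinity> then Max (insert 0 ((\<lambda>i. norm (x i)) ` {..<n}))
     else (\<Sum>i<n. norm (x i) powr real_of_ereal p) powr (1 / real_of_ereal p))"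

definition weak_lp_norm :: "ereal \<Rightarrow> nat \<Rightarrow> (nat \<Rightarrow> 'a::complex_normed_vector) \<Rightarrow> real"
  where "weak_lp_norm p n x =
    (SUP \<phi> \<in> (cball 0 1 :: 'a cdual set). lp_norm p n (\<lambda>i. cdual_apply \<phi> (x i)))"

definition cohen_bound ::
    "ereal \<Rightarrow> 'e set \<Rightarrow> ('e \<Rightarrow> 'f::complex_normed_vector) \<Rightarrow> real \<Rightarrow> bool"
  where "cohen_bound p U f C \<longleftrightarrow> 0 \<le> C \<and>
    (\<forall>n (l :: nat \<Rightarrow> complex) (x :: nat \<Rightarrow> 'e) (y :: nat \<Rightarrow> 'f cdual).
      (\<forall>i<n. x i \<in> U) \<longrightarrow>
      (\<Sum>i<n. cmod (l i) * cmod (cdual_apply (y i) (f (x i))))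
        \<le> C * lp_norm p n l * weak_lp_norm (conjugate_index p) n y)"

definition cohen_summing ::
    "ereal \<Rightarrow> 'e::complex_normed_vector set \<Rightarrow> ('e \<Rightarrow> 'f::complex_normed_vector) set"
  where "cohen_summing p U = {f. holomorphic_map_on f U \<and> (\<exists>C. cohen_bound p U f C)}"

definition cohen_norm :: "ereal \<Rightarrow> 'e set \<Rightarrow> ('e \<Rightarrow> 'f::complex_normed_vector) \<Rightarrow> real"
  where "cohen_norm p U f = Inf {C. cohen_bound p U f C}"

definition summing_bound ::
    "ereal \<Rightarrow> ('x::complex_normed_vector \<Rightarrow> 'y::complex_normed_vector) \<Rightarrow> real \<Rightarrow> bool"
  where "summing_bound q T C \<longleftrightarrow> 0 \<le> C \<and>
    (\<forall>n (x :: nat \<Rightarrow> 'x). lp_norm q n (\<lambda>i. T (x i)) \<le> C * weak_lp_norm q n x)"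

text \<open>
  \<open>summing_operators q Y\<close> is \<open>\<Pi>\<^sub>q(X, Y)\<close> with \<open>X\<close> the whole type \<open>'x\<close> and \<open>Y\<close> a linear subspace
  of the type \<open>'y\<close>, normed by restriction.
\<close>

definition summing_operators ::
    "ereal \<Rightarrow> 'y set \<Rightarrow> ('x::complex_normed_vector \<Rightarrow> 'y::complex_normed_vector) set"
  where "summing_operators q Y =
    {T. bounded_clinear T \<and> range T \<subseteq> Y \<and> (\<exists>C. summing_bound q T C)}"

definition summing_norm ::
    "ereal \<Rightarrow> ('x::complex_normed_vector \<Rightarrow> 'y::complex_normed_vector) \<Rightarrow> real"
  where "summing_norm q T = Inf {C. summing_bound q T C}"

end

theory Submission
  imports Defs
begin

text \<open>
  Write \<open>q\<close> for the conjugate index of \<open>p\<close>; since \<open>p > 1\<close>, it is finite. The theorem holds constant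
  by constant: a number \<open>C\<close> is admissible in the Cohen inequality for \<open>f\<close> if and only if it is
  admissible in the \<open>q\<close>-summing inequality for the transpose of \<open>f\<close>
  (\<open>cohen_bound_iff_summing_bound\<close>). Membership in both classes and the equality of the two infima
  are then immediate, once the transpose is known to be a bounded operator into \<open>Hinf U\<close>.

  Both inequalities are compared with the condition that
  \<open>lp_norm q n (\<lambda>i. y\<^sub>i (f x\<^sub>i)) \<le> C * weak_lp_norm q n y\<close> for all points \<open>x\<^sub>i \<in> U\<close> and functionals
  \<open>y\<^sub>i\<close>. The Cohen inequality is this condition tested against the scalars \<open>\<lambda>\<^sub>i\<close>, so the two agree by
  the duality of \<open>\<ell>\<^sub>p\<^sup>n\<close> and \<open>\<ell>\<^sub>q\<^sup>n\<close> (\<open>cohen_bound_iff_lp_bound\<close>). The summing inequality has the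
  supremum norms of the functions \<open>y\<^sub>i \<circ> f\<close> in place of their values at \<open>x\<^sub>i\<close>; as the \<open>x\<^sub>i\<close> may be chosen
  independently of each other, each value can be brought up to \<open>t\<close> times the supremum, for any
  \<open>t < 1\<close>, and \<open>t\<close> tends to \<open>1\<close> by homogeneity.
\<close>

section \<open>The duality of finite-dimensional sequence spaces\<close>

lemma conjugate_index_cases:
  assumes "1 < p"
  obtains (infinite) "p = \<infinity>" "conjugate_index p = ereal 1"
  | (finite) r s where "p = ereal r" "conjugate_index p = ereal s" "1 < r" "1 < s"
      "1 / r + 1 / s = 1"
proof (cases p)
  case (real r)
  with assms have r: "1 < r" by simp
  have "1 < r / (r - 1)" "1 / r + 1 / (r / (r - 1)) = 1"
    using r by (auto simp: field_simps)
  with real r show ?thesis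
    by (intro finite[of r "r / (r - 1)"]) (auto simp: conjugate_index_def one_ereal_def)
next
  case PInf
  then show ?thesis
    by (intro infinite) (auto simp: conjugate_index_def one_ereal_def)
qed (use assms in auto)

lemma conjugate_index_real:
  assumes "1 < p"
  obtains s where "conjugate_index p = ereal s" "1 \<le> s"
  using assms by (cases rule: conjugate_index_cases) auto

lemma lp_norm_nonneg: "0 \<le> lp_norm p n x"
  by (auto simp: lp_norm_def)

lemma lp_norm_infinity: "i < n \<Longrightarrow> norm (x i) \<le> lp_norm \<infinity> n x"
  by (auto simp: lp_norm_def intro!: Max_ge)

lemma lp_norm_1: "lp_norm (ereal 1) n x = (\<Sum>i<n. norm (x i))"
  by (simp add: lp_norm_def sum_nonneg)

lemma lp_norm_mono:
  assumes "0 \<le> s" and "\<And>i. i < n \<Longrightarrow> norm (x i) \<le> norm (y i)"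
  shows "lp_norm (ereal s) n x \<le> lp_norm (ereal s) n y"
  using assms by (auto simp: lp_norm_def intro!: powr_mono2 sum_mono sum_nonneg)

lemma lp_norm_scaleR:
  assumes "0 < s"
  shows "lp_norm (ereal s) n (\<lambda>i. t *\<^sub>R x i) = \<bar>t\<bar> * lp_norm (ereal s) n x"
proof -
  have "(\<Sum>i<n. norm (t *\<^sub>R x i) powr s) = \<bar>t\<bar> powr s * (\<Sum>i<n. norm (x i) powr s)"
    by (simp add: powr_mult sum_distrib_left)
  then show ?thesis
    using assms by (simp add: lp_norm_def powr_mult sum_nonneg powr_powr)
qed

lemma lp_norm_powr:
  assumes "0 < s"
  shows "lp_norm (ereal s) n x powr s = (\<Sum>i<n. norm (x i) powr s)"
  using assms by (simp add: lp_norm_def powr_powr sum_nonneg)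

lemma Holder_inequality_lp_norm:
  fixes a :: "nat \<Rightarrow> 'a::real_normed_vector" and b :: "nat \<Rightarrow> 'b::real_normed_vector"
  assumes "1 < p"
  shows "(\<Sum>i<n. norm (a i) * norm (b i)) \<le> lp_norm p n a * lp_norm (conjugate_index p) n b"
  using assms
proof (cases rule: conjugate_index_cases)
  case infinite
  have "(\<Sum>i<n. norm (a i) * norm (b i)) \<le> (\<Sum>i<n. lp_norm \<infinity> n a * norm (b i))"
    by (intro sum_mono mult_right_mono lp_norm_infinity) auto
  then show ?thesis
    unfolding infinite(2) lp_norm_1 by (simp add: infinite(1) sum_distrib_left)
next
  case (finite r s)
  define A where "A = lp_norm (ereal r) n a"
  define B where "B = lp_norm (ereal s) n b"
  have A: "A powr r = (\<Sum>i<n. norm (a i) powr r)" and B: "B powr s = (\<Sum>i<n. norm (b i) powr s)"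
    unfolding A_def B_def using finite by (simp_all add: lp_norm_powr)
  have nonneg: "0 \<le> A" "0 \<le> B"
    unfolding A_def B_def by (rule lp_norm_nonneg)+
  have "(\<Sum>i<n. norm (a i) * norm (b i)) \<le> A * B"
  proof (cases "A = 0 \<or> B = 0")
    case True
    then have "\<forall>i<n. norm (a i) = 0 \<or> norm (b i) = 0"
      using A B finite by (auto simp: sum_nonneg_eq_0_iff)
    then have "(\<Sum>i<n. norm (a i) * norm (b i)) = 0"
      by (intro sum.neutral) auto
    with nonneg show ?thesis by simp
  next
    case False
    with nonneg have pos: "0 < A" "0 < B" by auto
    \<comment> \<open>Young's inequality applied termwise to the sequences normalised to have norm \<open>1\<close>.\<close>
    have "(\<Sum>i<n. norm (a i) / A * (norm (b i) / B))
        \<le> (\<Sum>i<n. (norm (a i) / A) powr r / r + (norm (b i) / B) powr s / s)"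
      using finite pos by (intro sum_mono Youngs_inequality) auto
    also have "\<dots> = (\<Sum>i<n. norm (a i) powr r) / A powr r / r
        + (\<Sum>i<n. norm (b i) powr s) / B powr s / s"
      using pos by (simp add: powr_divide sum.distrib sum_divide_distrib)
    also have "\<dots> = 1"
      using pos finite by (simp flip: A B)
    finally have "(\<Sum>i<n. norm (a i) * norm (b i)) / (A * B) \<le> 1"
      by (simp add: sum_divide_distrib)
    with pos show ?thesis by (simp add: field_simps)
  qed
  then show ?thesis
    unfolding finite(2) by (simp add: A_def B_def finite(1))
qed

text \<open>
  Equality in the Holder inequality is attained at \<open>l\<^sub>i\<close> proportional to \<open>\<parallel>a\<^sub>i\<parallel> powr (s - 1)\<close>, where
  \<open>s\<close> is the conjugate index, because \<open>(s - 1) * r = s\<close> when \<open>1 / r + 1 / s = 1\<close>.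
\<close>

lemma lp_norm_attained:
  fixes a :: "nat \<Rightarrow> 'a::real_normed_vector"
  assumes "1 < p"
  obtains l :: "nat \<Rightarrow> complex" where "lp_norm p n l \<le> 1"
    and "(\<Sum>i<n. cmod (l i) * norm (a i)) = lp_norm (conjugate_index p) n a"
  using assms
proof (cases rule: conjugate_index_cases)
  case infinite
  have "lp_norm p n (\<lambda>i. 1 :: complex) \<le> 1"
    by (auto simp: lp_norm_def infinite)
  then show ?thesis
    using that[of "\<lambda>i. 1"] unfolding infinite(2) lp_norm_1 by simp
next
  case (finite r s)
  define N where "N = lp_norm (ereal s) n a"
  have N: "N powr s = (\<Sum>i<n. norm (a i) powr s)"
    unfolding N_def using finite by (simp add: lp_norm_powr)
  have nonneg: "0 \<le> N"
    unfolding N_def by (rule lp_norm_nonneg)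
  have conj: "(s - 1) * r = s"
    using finite by (simp add: field_simps)
  show ?thesis
  proof (cases "N = 0")
    case True
    show ?thesis
    proof (rule that[of "\<lambda>i. 0"])
      show "lp_norm p n (\<lambda>i. 0 :: complex) \<le> 1"
        by (simp add: lp_norm_def finite(1))
      show "(\<Sum>i<n. cmod 0 * norm (a i)) = lp_norm (conjugate_index p) n a"
        using True unfolding finite(2) N_def by simp
    qed
  next
    case False
    with nonneg have pos: "0 < N" by simp
    define l where "l i = complex_of_real ((norm (a i) / N) powr (s - 1))" for i
    have cmod_l: "cmod (l i) = (norm (a i) / N) powr (s - 1)" for i
      unfolding l_def norm_of_real by simp
    have "(\<Sum>i<n. cmod (l i) powr r) = (\<Sum>i<n. norm (a i) powr s) / N powr s"
      using pos by (simp add: cmod_l powr_powr conj powr_divide sum_divide_distrib)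
    then have norm_l: "lp_norm p n l \<le> 1"
      using pos by (simp add: lp_norm_def finite(1) flip: N)
    have summand: "cmod (l i) * norm (a i) = norm (a i) powr s / N powr (s - 1)" for i
      using pos by (cases "a i = 0") (simp_all add: cmod_l powr_divide powr_diff)
    have "(\<Sum>i<n. cmod (l i) * norm (a i)) = (\<Sum>i<n. norm (a i) powr s) / N powr (s - 1)"
      unfolding summand by (simp add: sum_divide_distrib)
    also have "\<dots> = N"
      using pos by (simp add: powr_diff flip: N)
    finally show ?thesis
      using that[OF norm_l] unfolding finite(2) N_def by blast
  qed
qed


section \<open>Norms of functionals, weak norms and supremum norms\<close>

lemma cmod_cdual_apply_le: "cmod (cdual_apply \<phi> x) \<le> norm \<phi> * norm x"
  by transfer (simp add: onorm bounded_clinearD)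

lemma cdual_apply_zero: "cdual_apply \<phi> 0 = 0"
  using cmod_cdual_apply_le[of \<phi> 0] by simp

lemma weak_lp_norm_nonneg:
  assumes "0 \<le> s"
  shows "0 \<le> weak_lp_norm (ereal s) n (x :: nat \<Rightarrow> 'a::complex_normed_vector)"
proof -
  have "cmod (cdual_apply \<phi> (x i)) \<le> norm (x i)" if "norm \<phi> \<le> 1" for \<phi> :: "'a cdual" and i
    using cmod_cdual_apply_le[of \<phi> "x i"] mult_right_mono[OF that, of "norm (x i)"] by simp
  \<comment> \<open>A real supremum is meaningful only for a set that is bounded above.\<close>
  then have "bdd_above ((\<lambda>\<phi>. lp_norm (ereal s) n (\<lambda>i. cdual_apply \<phi> (x i)))
      ` (cball 0 1 :: 'a cdual set))"
    by (intro bdd_aboveI2[of _ _ "lp_norm (ereal s) n x"] lp_norm_mono[OF assms])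
      (auto simp: mem_cball dist_norm)
  then have "lp_norm (ereal s) n (\<lambda>i. cdual_apply 0 (x i)) \<le> weak_lp_norm (ereal s) n x"
    unfolding weak_lp_norm_def by (intro cSUP_upper) auto
  with lp_norm_nonneg show ?thesis
    by (rule order_trans)
qed

lemma norm_bfun_apply_le: "norm (bfun_apply g x) \<le> norm g"
  by transfer (rule norm_le_SUP_norm)

lemma norm_bfun_le:
  assumes "\<And>x. norm (bfun_apply g x) \<le> B"
  shows "norm g \<le> B"
  using assms by transfer (auto intro: cSUP_least)

text \<open>
  For a function that is extended by \<open>0\<close>, any point with a nonzero value lies in \<open>U\<close>; the hypothesis
  that \<open>U\<close> is nonempty serves the zero function.
\<close>

lemma norm_bfun_almost_attained:
  fixes g :: "('a, 'b::complex_normed_vector) bfun"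
  assumes "U \<noteq> {}" and "\<And>x. x \<notin> U \<Longrightarrow> bfun_apply g x = 0" and "0 \<le> t" "t < 1"
  obtains x where "x \<in> U" "t * norm g \<le> norm (bfun_apply g x)"
proof (cases "g = 0")
  case True
  with assms(1) that show ?thesis by auto
next
  case False
  with \<open>t < 1\<close> have "\<not> norm g \<le> t * norm g"
    by (simp add: not_le)
  with norm_bfun_le[of g "t * norm g"] obtain x where x: "t * norm g < norm (bfun_apply g x)"
    by (meson not_le)
  moreover have "0 \<le> t * norm g"
    using \<open>0 \<le> t\<close> by simp
  ultimately have "bfun_apply g x \<noteq> 0" by auto
  with assms(2) x that show ?thesis by (metis less_imp_le)
qed


section \<open>The transpose as an operator into the bounded holomorphic functions\<close>

lemma bounded_clinear_transpose_map:
  fixes f :: "('a, 'b::complex_normed_vector) bfun"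
  shows "bounded_clinear (transpose_map f)"
proof -
  have "bounded_linear (transpose_map f)"
  proof (rule bounded_linear_intro[where K = "norm f"])
    fix y z :: "'b cdual" and r :: real
    show "transpose_map f (y + z) = transpose_map f y + transpose_map f z"
      by transfer (simp add: plus_cdual.rep_eq)
    show "transpose_map f (r *\<^sub>R y) = r *\<^sub>R transpose_map f y"
      by transfer (simp add: scaleR_cdual.rep_eq)
    have "cmod (bfun_apply (transpose_map f y) x) \<le> norm y * norm f" for x
      unfolding transpose_map.rep_eq
      by (rule order_trans[OF cmod_cdual_apply_le mult_left_mono[OF norm_bfun_apply_le]]) simp
    then show "norm (transpose_map f y) \<le> norm y * norm f"
      by (rule norm_bfun_le)
  qed
  moreover have "transpose_map f (c *\<^sub>C y) = c *\<^sub>C transpose_map f y" for c y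
    by transfer (simp add: scaleC_cdual.rep_eq)
  ultimately show ?thesis
    by (simp add: bounded_clinear_def)
qed

lemma transpose_map_in_Hinf:
  assumes "f \<in> Hinf U"
  shows "transpose_map f y \<in> Hinf U"
proof -
  have y: "bounded_linear (cdual_apply y)" "\<And>c v. cdual_apply y (c *\<^sub>C v) = c * cdual_apply y v"
    using cdual_apply[of y] by (auto simp: bounded_clinear_def)
  have "\<exists>D. bounded_clinear D \<and> (bfun_apply (transpose_map f y) has_derivative D) (at x)"
    if "x \<in> U" for x
  proof -
    from assms that obtain D where D: "bounded_clinear D" "(bfun_apply f has_derivative D) (at x)"
      unfolding Hinf_def holomorphic_map_on_def by blast
    then show ?thesis
      unfolding transpose_map.rep_eq
      by (intro exI[of _ "\<lambda>v. cdual_apply y (D v)"])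
        (auto simp: bounded_clinear_def y(2) intro: bounded_linear_compose[OF y(1)]
          bounded_linear.has_derivative[OF y(1)])
  qed
  with assms show ?thesis
    by (simp add: Hinf_def holomorphic_map_on_def transpose_map.rep_eq cdual_apply_zero)
qed


section \<open>Comparison of the admissible constants\<close>

text \<open>
  The Cohen inequality bounds the pairing of \<open>(\<lambda>\<^sub>i)\<close> with the values \<open>y\<^sub>i (f x\<^sub>i)\<close>, and its right-hand
  side is proportional to the norm of \<open>(\<lambda>\<^sub>i)\<close>. For fixed \<open>x\<^sub>i\<close> and \<open>y\<^sub>i\<close> the scalars can therefore be
  eliminated by Holder's inequality in one direction and a norming sequence in the other.
\<close>

lemma cohen_bound_iff_lp_bound:
  assumes "1 < p"
  shows "cohen_bound p U f C \<longleftrightarrow> 0 \<le> C \<and>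
    (\<forall>n x y. (\<forall>i<n. x i \<in> U) \<longrightarrow>
      lp_norm (conjugate_index p) n (\<lambda>i. cdual_apply (y i) (f (x i)))
        \<le> C * weak_lp_norm (conjugate_index p) n y)"
  (is "_ \<longleftrightarrow> 0 \<le> C \<and> ?lp_bound")
proof safe
  assume cohen: "cohen_bound p U f C"
  then show C: "0 \<le> C" by (simp add: cohen_bound_def)
  fix n :: nat and x and y :: "nat \<Rightarrow> 'b cdual"
  assume x: "\<forall>i<n. x i \<in> U"
  let ?w = "C * weak_lp_norm (conjugate_index p) n y"
  from assms obtain s where "conjugate_index p = ereal s" "1 \<le> s"
    by (rule conjugate_index_real)
  then have w: "0 \<le> ?w"
    using C by (simp add: weak_lp_norm_nonneg)
  from assms obtain l :: "nat \<Rightarrow> complex" where l: "lp_norm p n l \<le> 1"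
    and eq: "(\<Sum>i<n. cmod (l i) * cmod (cdual_apply (y i) (f (x i))))
      = lp_norm (conjugate_index p) n (\<lambda>i. cdual_apply (y i) (f (x i)))"
    by (rule lp_norm_attained)
  have "lp_norm (conjugate_index p) n (\<lambda>i. cdual_apply (y i) (f (x i))) \<le> lp_norm p n l * ?w"
    unfolding eq[symmetric] using cohen x by (simp add: cohen_bound_def mult_ac)
  also have "\<dots> \<le> ?w"
    using mult_right_mono[OF l w] by simp
  finally show "lp_norm (conjugate_index p) n (\<lambda>i. cdual_apply (y i) (f (x i))) \<le> ?w" .
next
  assume C: "0 \<le> C" and lp_bound: ?lp_bound
  have "(\<Sum>i<n. cmod (l i) * cmod (cdual_apply (y i) (f (x i))))
      \<le> C * lp_norm p n l * weak_lp_norm (conjugate_index p) n y"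
    if x: "\<forall>i<n. x i \<in> U" for n l x and y :: "nat \<Rightarrow> 'b cdual"
  proof -
    have "(\<Sum>i<n. cmod (l i) * cmod (cdual_apply (y i) (f (x i))))
        \<le> lp_norm p n l * lp_norm (conjugate_index p) n (\<lambda>i. cdual_apply (y i) (f (x i)))"
      using assms by (rule Holder_inequality_lp_norm)
    also have "\<dots> \<le> lp_norm p n l * (C * weak_lp_norm (conjugate_index p) n y)"
      using lp_bound x by (intro mult_left_mono lp_norm_nonneg) auto
    finally show ?thesis by (simp add: mult_ac)
  qed
  with C show "cohen_bound p U f C" by (simp add: cohen_bound_def)
qed

text \<open>
  Passing from values to supremum norms uses that the points \<open>x\<^sub>i\<close> are independent of each other, so
  that all the suprema can be approached simultaneously. If \<open>U\<close> is empty there are no points to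
  choose, but then the transpose vanishes.
\<close>

lemma cohen_bound_iff_summing_bound:
  fixes f :: "('e, 'f::complex_normed_vector) bfun"
  assumes p: "1 < p" and f: "\<And>x. x \<notin> U \<Longrightarrow> bfun_apply f x = 0"
  shows "cohen_bound p U (bfun_apply f) C
    \<longleftrightarrow> summing_bound (conjugate_index p) (transpose_map f) C"
proof -
  from p obtain s where s: "conjugate_index p = ereal s" "1 \<le> s"
    by (rule conjugate_index_real)
  have "lp_norm (ereal s) n (\<lambda>i. transpose_map f (y i)) \<le> C * weak_lp_norm (ereal s) n y"
    if cohen: "cohen_bound p U (bfun_apply f) C" for n y
  proof (cases "U = {}")
    case True
    with f have "transpose_map f z = 0" for z
      by (auto simp: bfun_apply_inject[symmetric] transpose_map.rep_eq zero_bfun.rep_eq fun_eq_iff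
          cdual_apply_zero)
    with s cohen show ?thesis
      by (simp add: lp_norm_def weak_lp_norm_nonneg cohen_bound_def)
  next
    case False
    have off: "bfun_apply (transpose_map f z) x = 0" if "x \<notin> U" for z x
      using f[OF that] by (simp add: transpose_map.rep_eq cdual_apply_zero)
    have "t * lp_norm (ereal s) n (\<lambda>i. transpose_map f (y i)) \<le> C * weak_lp_norm (ereal s) n y"
      if t: "0 < t" "t < 1" for t
    proof -
      have "\<forall>i. \<exists>x. x \<in> U \<and>
          t * norm (transpose_map f (y i)) \<le> norm (bfun_apply (transpose_map f (y i)) x)"
        using norm_bfun_almost_attained[OF False off, of t] t by (metis less_imp_le)
      then obtain x where x: "\<And>i. x i \<in> U"
        "\<And>i. t * norm (transpose_map f (y i)) \<le> norm (bfun_apply (transpose_map f (y i)) (x i))"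
        by metis
      have "t * lp_norm (ereal s) n (\<lambda>i. transpose_map f (y i))
          = lp_norm (ereal s) n (\<lambda>i. t *\<^sub>R transpose_map f (y i))"
        using s t by (subst lp_norm_scaleR) auto
      also have "\<dots> \<le> lp_norm (ereal s) n (\<lambda>i. bfun_apply (transpose_map f (y i)) (x i))"
        using s t x(2) by (intro lp_norm_mono) auto
      also have "\<dots> \<le> C * weak_lp_norm (ereal s) n y"
        using cohen x(1) unfolding cohen_bound_iff_lp_bound[OF p] s(1) transpose_map.rep_eq by blast
      finally show ?thesis .
    qed
    then show ?thesis
      by (rule field_le_mult_one_interval)
  qed
  moreover have "lp_norm (ereal s) n (\<lambda>i. cdual_apply (y i) (bfun_apply f (x i)))
      \<le> C * weak_lp_norm (ereal s) n y"
    if summing: "summing_bound (ereal s) (transpose_map f) C" for n x y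
  proof -
    have "cmod (cdual_apply (y i) (bfun_apply f (x i))) \<le> norm (transpose_map f (y i))" for i
      using norm_bfun_apply_le[of "transpose_map f (y i)" "x i"] by (simp add: transpose_map.rep_eq)
    with s have "lp_norm (ereal s) n (\<lambda>i. cdual_apply (y i) (bfun_apply f (x i)))
        \<le> lp_norm (ereal s) n (\<lambda>i. transpose_map f (y i))"
      by (intro lp_norm_mono) simp_all
    with summing show ?thesis
      unfolding summing_bound_def by (blast intro: order_trans)
  qed
  ultimately show ?thesis
    using cohen_bound_iff_lp_bound[OF p, of U "bfun_apply f" C]
    unfolding s(1) by (auto simp: summing_bound_def)
qed

theorem theorem5p9:
  fixes U :: "'e::cbanach set" and f :: "('e, 'f::cbanach) bfun" and p :: ereal
  assumes "open U" and "1 < p" and "f \<in> Hinf U"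
  shows "(bfun_apply f \<in> cohen_summing p U \<longleftrightarrow>
           transpose_map f \<in> summing_operators (conjugate_index p) (Hinf U)) \<and>
         (bfun_apply f \<in> cohen_summing p U \<longrightarrow>
           cohen_norm p U (bfun_apply f) = summing_norm (conjugate_index p) (transpose_map f))"
proof -
  have bounds: "cohen_bound p U (bfun_apply f)
      = summing_bound (conjugate_index p) (transpose_map f)"
    using assms by (intro ext cohen_bound_iff_summing_bound) (auto simp: Hinf_def)
  have "holomorphic_map_on (bfun_apply f) U"
    using assms by (simp add: Hinf_def)
  moreover have "range (transpose_map f) \<subseteq> Hinf U"
    using transpose_map_in_Hinf[OF assms(3)] by auto
  ultimately show ?thesis
    by (simp add: cohen_summing_def summing_operators_def cohen_norm_def summing_norm_def bounds
        bounded_clinear_transpose_map)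
qed

end
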